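(* Let $D=\{z\in\mathbb{C}:|z|<1\}$, $D^+=\{z\in D:\operatorname{Im}(z)>0\}$ and $L=D\cap\mathbb{R}$. Let $f$ be holomorphic on $D^+$ and suppose that $\operatorname{Im}(f)$ extends to a continuous function on $D^+\cup L$; denote the restriction of this extension to $L$ by $x\mapsto v(x,0)$. Suppose that $v(x,0)$ is real analytic at $0$ with radius of convergence $r$, i.e. $0<r\le 1$ and there are real numbers $a_n$ ($n\ge 0$) with $v(x,0)=\sum_{n\ge 0}a_nx^n$ for all real $x$ with $|x|<r$. Put $D_r=\{z\in\mathbb{C}:|z|<r\}$, $D_r^+=\{z\in D_r:\operatorname{Im}(z)>0\}$, and let $v(z,0)=\sum_{n\ge0}a_nz^n$ for $z\in D_r$, a holomorphic function on $D_r$. Then there exists a function $F$ holomorphic on $D^+\cup D_r$ such that $$F(z)=\begin{cases} f(z) & \text{for } z\in D^+,\\ \overline{f(\overline z)}+2i\,v(z,0) & \text{for } z\in D_r\setminus D_r^+,\end{cases}$$ where for real $z\in(-r,r)$ the symbol $f(z)$ denotes the limit of $f(\zeta)$ as $\zeta\to z$ with $\zeta\in D^+$ (the existence of this limit being part of the assertion). *)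

theory Defs
  imports "HOL-Complex_Analysis.Complex_Analysis"
begin

definition upper_half_disc :: "real \<Rightarrow> complex set" where
  "upper_half_disc r = {z \<in> ball 0 r. Im z > 0}"

definition real_diameter :: "complex set" where
  "real_diameter = ball 0 1 \<inter> \<real>"

text \<open>The complexification \<open>v(z,0)\<close> of the real power series with coefficients \<open>a\<close>; it is only
  meaningful where the series converges.\<close>

definition complexified_series :: "(nat \<Rightarrow> real) \<Rightarrow> complex \<Rightarrow> complex" where
  "complexified_series a z = (\<Sum>n. complex_of_real (a n) * z ^ n)"

text \<open>The convention for \<open>f(z)\<close>: the value of \<open>f\<close> on the open upper half disc, and the limit from
  the upper half disc elsewhere. As \<^const>\<open>Lim\<close> is total, existence of the limit has to be asserted
  separately.\<close>

definition boundary_value_ext :: "(complex \<Rightarrow> complex) \<Rightarrow> complex \<Rightarrow> complex" where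
  "boundary_value_ext f z =
     (if z \<in> upper_half_disc 1 then f z else Lim (at z within upper_half_disc 1) f)"

end

theory Submission imports Defs begin

text \<open>
  On the real segment the complexified series \<open>v\<close> takes the values of \<open>V\<close>, so the function
  \<open>g = f - \<i> v\<close>, holomorphic on the upper half of the disc of radius \<open>r\<close>, has an imaginary part
  that tends to \<open>0\<close> at every point of the segment. If \<open>g\<close> reflects across the segment to a
  holomorphic function \<open>G\<close>, then \<open>H = G + \<i> v\<close> continues \<open>f\<close>, and below the real axis
  \<open>H z = cnj (g (cnj z)) + \<i> v z = cnj (f (cnj z)) + 2 \<i> v z\<close>, because \<open>v\<close> has real coefficients
  and hence commutes with conjugation.

  The classical reflection principle requires \<open>g\<close> itself, and not only its imaginary part, to be
  continuous up to the segment. Mere convergence of \<open>Im g\<close> to \<open>0\<close> gives by the Cauchy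
  inequality only \<open>deriv g z = o(1 / Im z)\<close>, a bound that need not be integrable. A barrier improves this:
  the function \<open>A y + K ((x - c)\<^sup>2 - y\<^sup>2)\<close> is harmonic and, for suitable \<open>A\<close> and \<open>K\<close>, dominates
  \<open>Im g\<close> on the boundary of a rectangle standing on the segment, so by the maximum principle
  \<open>Im g = O(Im z)\<close> near the segment (\<open>Im_le_linear_in_height\<close>). On a disc around \<open>z\<close> of radius
  \<open>Im z / 2\<close> this makes \<open>deriv g\<close> bounded (\<open>deriv_bound_by_Im\<close>). Therefore \<open>g\<close> is Lipschitz near
  each point of the segment, has a limit there (\<open>limit_at_real_point\<close>), and the classical
  principle applies (\<open>Schwarz_reflection_Im\<close>).
\<close>

section \<open>Harmonic majorants for the imaginary part\<close>

text \<open>The maximum modulus principle for \<open>exp (- \<i> f)\<close>, whose modulus is \<open>exp (Im f)\<close>. Only the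
  imaginary part of \<open>f\<close> is continuous up to the boundary, so the modulus principle cannot be
  applied on the closure; it shows instead that an interior maximum of \<open>u\<close> makes
  \<open>u\<close> constant, and continuity of \<open>u\<close> carries that constant to the boundary.\<close>

lemma Im_maximum_principle:
  fixes f :: "complex \<Rightarrow> complex" and u :: "complex \<Rightarrow> real"
  assumes holf: "f holomorphic_on S"
    and S: "open S" "connected S" "bounded S"
    and contu: "continuous_on (closure S) u"
    and u: "\<And>z. z \<in> S \<Longrightarrow> u z = Im (f z)"
    and leB: "\<And>z. z \<in> frontier S \<Longrightarrow> u z \<le> B"
    and "z \<in> S"
  shows "Im (f z) \<le> B"
proof -
  have "compact (closure S)"
    using S by (simp add: compact_closure)
  moreover have "closure S \<noteq> {}"
    using \<open>z \<in> S\<close> by auto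
  ultimately obtain p where p: "p \<in> closure S" and pmax: "\<And>w. w \<in> closure S \<Longrightarrow> u w \<le> u p"
    using continuous_attains_sup[OF _ _ contu] by blast
  have "u p \<le> B"
  proof (cases "p \<in> frontier S")
    case True
    then show ?thesis by (rule leB)
  next
    case False
    then have pS: "p \<in> S"
      using p S(1) by (simp add: frontier_def interior_open)
    have norm_exp: "norm (exp (- \<i> * f w)) = exp (u w)" if "w \<in> S" for w
      using u[OF that] by (simp add: norm_exp_eq_Re)
    have "(\<lambda>w. exp (- \<i> * f w)) constant_on S"
    proof (rule maximum_modulus_principle[OF _ S(1) S(2) S(1) subset_refl pS])
      show "(\<lambda>w. exp (- \<i> * f w)) holomorphic_on S"
        by (intro holomorphic_intros holf)
      show "norm (exp (- \<i> * f w)) \<le> norm (exp (- \<i> * f p))" if "w \<in> S" for w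
        using pmax[of w] that closure_subset[of S] unfolding norm_exp[OF that] norm_exp[OF pS] by auto
    qed
    then have "u w = u p" if "w \<in> S" for w
      using norm_exp[OF that] norm_exp[OF pS] that pS
      by (metis constant_on_def exp_inj_iff)
    then have const: "u w = u p" if "w \<in> closure S" for w
      using continuous_constant_on_closure[OF contu _ that] by blast
    have "frontier S \<noteq> {}"
      using S(3) \<open>z \<in> S\<close> not_bounded_UNIV frontier_eq_empty by blast
    then obtain q where "q \<in> frontier S" by blast
    then show ?thesis
      using const[of q] leB[of q] by (simp add: frontier_def)
  qed
  moreover have "Im (f z) \<le> u p"
    using pmax[of z] u[OF \<open>z \<in> S\<close>] \<open>z \<in> S\<close> closure_subset[of S] by auto
  ultimately show ?thesis by linarith
qed

text \<open>The barrier \<open>q\<close> with \<open>K = M / d\<^sup>2\<close> and \<open>A = 2 M / d\<close> is the imaginary part of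
  \<open>A z + \<i> K (z - c)\<^sup>2\<close>. It is nonnegative on the bottom side of the rectangle, where \<open>u\<close>
  vanishes, and at least \<open>M\<close> on the other three sides, so it dominates \<open>Im g\<close> inside; on the
  vertical line through the midpoint \<open>c\<close> it is at most \<open>A y\<close>.\<close>

lemma Im_le_linear_in_height:
  fixes g :: "complex \<Rightarrow> complex" and u :: "complex \<Rightarrow> real" and c d M y :: real
  defines "a \<equiv> Complex (c - d) 0" and "b \<equiv> Complex (c + d) d"
  assumes holg: "g holomorphic_on box a b"
    and contu: "continuous_on (cbox a b) u"
    and u: "\<And>z. z \<in> box a b \<Longrightarrow> u z = Im (g z)"
    and bottom: "\<And>z. z \<in> cbox a b \<Longrightarrow> Im z = 0 \<Longrightarrow> u z = 0"
    and M: "\<And>z. z \<in> cbox a b \<Longrightarrow> u z \<le> M" "0 \<le> M"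
    and y: "0 < y" "y < d"
  shows "Im (g (Complex c y)) \<le> 2 * M / d * y"
proof -
  define A where "A = 2 * M / d"
  define K where "K = M / d\<^sup>2"
  define q where "q z = A * Im z + K * ((Re z - c)\<^sup>2 - (Im z)\<^sup>2)" for z :: complex
  define Q where "Q z = of_real A * z + \<i> * of_real K * (z - of_real c)\<^sup>2" for z :: complex
  have ImQ: "Im (Q z) = q z" for z
    by (simp add: Q_def q_def power2_eq_square algebra_simps)
  have d: "d > 0" using y by simp
  have K: "K \<ge> 0" "K * d\<^sup>2 = M" "A * d = 2 * M" "A = 2 * (K * d)"
    using d M(2) by (auto simp: K_def A_def power2_eq_square)
  have in_box: "Complex c y \<in> box a b"
    using y by (simp add: a_def b_def in_box_complex_iff)
  then have cl: "closure (box a b) = cbox a b"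
    by (intro closure_box) auto
  have "Im (g (Complex c y) - Q (Complex c y)) \<le> 0"
  proof (rule Im_maximum_principle[where S = "box a b" and u = "\<lambda>z. u z - q z"
            and f = "\<lambda>z. g z - Q z"])
    show "(\<lambda>z. g z - Q z) holomorphic_on box a b"
      unfolding Q_def by (intro holomorphic_intros holg)
    show "connected (box a b)" by (intro convex_connected convex_box)
    show "continuous_on (closure (box a b)) (\<lambda>z. u z - q z)"
      unfolding cl q_def by (intro continuous_intros contu)
    show "u z - q z = Im (g z - Q z)" if "z \<in> box a b" for z
      using u[OF that] by (simp add: ImQ)
    show "u z - q z \<le> 0" if "z \<in> frontier (box a b)" for z
    proof -
      have zc: "z \<in> cbox a b" and nb: "z \<notin> box a b"
        using that by (auto simp: frontier_def cl interior_open[OF open_box])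
      have bnd: "\<bar>Re z - c\<bar> \<le> d" "0 \<le> Im z" "Im z \<le> d"
        using zc by (auto simp: a_def b_def in_cbox_complex_iff)
      have "Im z = 0 \<or> \<bar>Re z - c\<bar> = d \<or> Im z = d"
        using nb bnd by (auto simp: a_def b_def in_box_complex_iff)
      then consider "Im z = 0" | "(Re z - c)\<^sup>2 = d\<^sup>2" | "Im z = d"
        by (metis power2_abs)
      then show ?thesis
      proof cases
        case 1
        then show ?thesis using bottom[OF zc] K by (simp add: q_def)
      next
        case 2
        have "q z = M + K * (Im z * (2 * d - Im z))"
          unfolding q_def 2 K(4) K(2)[symmetric] by (simp add: power2_eq_square algebra_simps)
        moreover have "0 \<le> K * (Im z * (2 * d - Im z))"
          using K bnd by (intro mult_nonneg_nonneg) auto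
        ultimately show ?thesis using M(1)[OF zc] by linarith
      next
        case 3
        have "q z = M + K * (Re z - c)\<^sup>2"
          unfolding q_def 3 using K(2,3) by (simp add: algebra_simps)
        moreover have "0 \<le> K * (Re z - c)\<^sup>2"
          using K by simp
        ultimately show ?thesis using M(1)[OF zc] by linarith
      qed
    qed
  qed (use in_box in \<open>auto simp: open_box\<close>)
  then have "Im (g (Complex c y)) \<le> q (Complex c y)"
    by (simp add: ImQ)
  also have "\<dots> \<le> A * y"
    using K by (simp add: q_def)
  finally show ?thesis by (simp add: A_def)
qed

section \<open>Boundary limits from a vanishing imaginary part\<close>

text \<open>The Cauchy inequality is applied to \<open>E = exp (- \<i> g / m)\<close>, whose modulus
  \<open>exp (Im g / m)\<close> lies between \<open>exp (- 1)\<close> and \<open>exp 1\<close> on the disc. This controls \<open>deriv g\<close>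
  without any bound on the real part of \<open>g\<close>.\<close>

lemma deriv_bound_by_Im:
  fixes g :: "complex \<Rightarrow> complex"
  assumes holg: "g holomorphic_on S" and S: "open S" "cball z \<rho> \<subseteq> S" and "0 < \<rho>"
    and m: "\<And>w. w \<in> cball z \<rho> \<Longrightarrow> \<bar>Im (g w)\<bar> \<le> m" "0 < m"
  shows "norm (deriv g z) \<le> exp 2 * m / \<rho>"
proof -
  define E where "E w = exp (- \<i> * g w / of_real m)" for w
  have z: "z \<in> cball z \<rho>" using \<open>0 < \<rho>\<close> by simp
  then have zS: "z \<in> S" using S by blast
  have holE: "E holomorphic_on S"
    unfolding E_def by (intro holomorphic_intros holg) (use m in auto)
  have normE: "norm (E w) = exp (Im (g w) / m)" for w
    by (simp add: E_def norm_exp_eq_Re)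
  have "norm (deriv E z) \<le> exp 1 / \<rho>"
  proof -
    have "norm ((deriv ^^ 1) E z) \<le> fact 1 * exp 1 / \<rho> ^ 1"
    proof (rule Cauchy_inequality[OF _ _ \<open>0 < \<rho>\<close>])
      show "E holomorphic_on ball z \<rho>" "continuous_on (cball z \<rho>) E"
        using holomorphic_on_subset[OF holE] S(2) ball_subset_cball[of z \<rho>]
        by (blast intro: holomorphic_on_imp_continuous_on)+
      show "norm (E w) \<le> exp 1" if "norm (z - w) = \<rho>" for w
      proof -
        have "Im (g w) \<le> m"
          using m(1)[of w] that by (simp add: dist_norm)
        then show ?thesis using m(2) by (simp add: normE divide_simps)
      qed
    qed
    then show ?thesis by simp
  qed
  moreover have "(E has_field_derivative (- \<i> * deriv g z / of_real m) * E z) (at z)"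
    unfolding E_def using m(2)
    by (auto intro!: derivative_eq_intros holomorphic_derivI[OF holg S(1) zS])
  then have "deriv E z = (- \<i> * deriv g z / of_real m) * E z"
    by (rule DERIV_imp_deriv)
  then have "norm (deriv E z) = norm (deriv g z) / m * norm (E z)"
    using m(2) by (simp add: norm_mult norm_divide)
  moreover have "exp (- 1) \<le> norm (E z)"
    using m(1)[OF z] m(2) by (simp add: normE field_simps)
  then have "norm (deriv g z) / m * exp (- 1) \<le> norm (deriv g z) / m * norm (E z)"
    using m(2) by (intro mult_left_mono) auto
  ultimately have "norm (deriv g z) / m * exp (- 1) \<le> exp 1 / \<rho>"
    by linarith
  then have "norm (deriv g z) / m * exp (- 1) * exp 1 \<le> exp 1 / \<rho> * exp 1"
    by (rule mult_right_mono) simp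
  then have "norm (deriv g z) / m \<le> exp 1 / \<rho> * exp 1"
    by (simp add: mult.assoc flip: exp_add)
  also have "\<dots> = exp 2 / \<rho>"
    by (simp flip: exp_add)
  finally show ?thesis
    using m(2) by (simp add: pos_divide_le_eq mult.commute)
qed

text \<open>Near \<open>x\<close> the linear bound \<open>\<bar>Im (g z)\<bar> \<le> (2 M / d) Im z\<close> offsets the shrinking
  radius in the derivative estimate, so that \<open>deriv g\<close> is bounded and \<open>g\<close> is Lipschitz, hence
  uniformly continuous, on a rectangle in the upper half plane that has \<open>x\<close>
  in its lower side.\<close>

lemma limit_at_real_point:
  fixes g :: "complex \<Rightarrow> complex" and u :: "complex \<Rightarrow> real"
  assumes S: "open S"
    and holg: "g holomorphic_on (S \<inter> {z. 0 < Im z})"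
    and contu: "continuous_on (S \<inter> {z. 0 \<le> Im z}) u"
    and u: "\<And>z. z \<in> S \<Longrightarrow> 0 < Im z \<Longrightarrow> u z = Im (g z)"
    and u0: "\<And>z. z \<in> S \<Longrightarrow> Im z = 0 \<Longrightarrow> u z = 0"
    and x: "x \<in> S" "Im x = 0"
  shows "\<exists>l. (g \<longlongrightarrow> l) (at x within S \<inter> {z. 0 < Im z})"
proof -
  let ?U = "S \<inter> {z. 0 < Im z}"
  have openU: "open ?U"
    using S by (intro open_Int open_halfspace_Im_gt)
  obtain e where e: "e > 0" "cball x e \<subseteq> S"
    using S x(1) open_contains_cball by blast
  define d where "d = e / 4"
  have d: "d > 0" using e by (simp add: d_def)
  define R where "R = cbox (Complex (Re x - 2 * d) 0) (Complex (Re x + 2 * d) (2 * d))"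
  have R_iff: "z \<in> R \<longleftrightarrow> \<bar>Re z - Re x\<bar> \<le> 2 * d \<and> 0 \<le> Im z \<and> Im z \<le> 2 * d" for z
    by (auto simp: R_def in_cbox_complex_iff)
  have R_sub: "R \<subseteq> S \<inter> {z. 0 \<le> Im z}"
  proof
    fix z assume z: "z \<in> R"
    have "norm (z - x) \<le> \<bar>Re (z - x)\<bar> + \<bar>Im (z - x)\<bar>" by (rule cmod_le)
    also have "\<dots> \<le> e" using z x(2) by (simp add: R_iff d_def)
    finally have "z \<in> S" using e(2) by (auto simp: dist_norm norm_minus_commute)
    then show "z \<in> S \<inter> {z. 0 \<le> Im z}" using z by (simp add: R_iff)
  qed
  have contR: "continuous_on R u"
    using contu R_sub by (rule continuous_on_subset)
  have "compact (u ` R)"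
    using contR by (intro compact_continuous_image) (simp_all add: R_def)
  then obtain M where M: "M > 0" "\<And>z. z \<in> R \<Longrightarrow> \<bar>u z\<bar> \<le> M"
    using compact_imp_bounded bounded_pos by (metis imageI real_norm_def)
  \<comment> \<open>The barrier bounds the imaginary part only above the midpoint of a rectangle. For every
    such \<open>z\<close> the rectangle of half-width \<open>d\<close> centred below \<open>z\<close> still lies in \<open>R\<close>, which has
    half-width \<open>2 d\<close>.\<close>
  have lin: "\<bar>Im (g z)\<bar> \<le> 2 * M / d * Im z" if "\<bar>Re z - Re x\<bar> \<le> d" "0 < Im z" "Im z < d" for z
  proof -
    let ?a = "Complex (Re z - d) 0" and ?b = "Complex (Re z + d) d"
    have sub: "cbox ?a ?b \<subseteq> R"
      using that by (auto simp: R_iff in_cbox_complex_iff)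
    have sub': "box ?a ?b \<subseteq> ?U"
      using sub R_sub box_subset_cbox[of ?a ?b] by (fastforce simp: in_box_complex_iff)
    have hol: "g holomorphic_on box ?a ?b"
      using holg sub' by (rule holomorphic_on_subset)
    have cont: "continuous_on (cbox ?a ?b) u"
      using contR sub by (rule continuous_on_subset)
    have ueq: "u w = Im (g w)" if "w \<in> box ?a ?b" for w
      using that sub' u by auto
    have zero: "u w = 0" if "w \<in> cbox ?a ?b" "Im w = 0" for w
      using that sub R_sub u0 by blast
    have bd: "\<bar>u w\<bar> \<le> M" if "w \<in> cbox ?a ?b" for w
      using that sub M(2) by blast
    have "Im (g (Complex (Re z) (Im z))) \<le> 2 * M / d * Im z"
      using bd M(1) that zero ueq by (intro Im_le_linear_in_height[where u = u, OF hol cont]) (auto simp: abs_le_iff)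
    moreover have "Im ((\<lambda>w. - g w) (Complex (Re z) (Im z))) \<le> 2 * M / d * Im z"
      using bd M(1) that zero ueq
      by (intro Im_le_linear_in_height[where u = "\<lambda>w. - u w"] holomorphic_intros hol continuous_intros cont)
         (auto simp: abs_le_iff)
    ultimately show ?thesis by simp
  qed
  define Q where "Q = box (Complex (Re x - d / 2) 0) (Complex (Re x + d / 2) (d / 2))"
  have Q_iff: "z \<in> Q \<longleftrightarrow> \<bar>Re z - Re x\<bar> < d / 2 \<and> 0 < Im z \<and> Im z < d / 2" for z
    unfolding Q_def in_box_complex_iff abs_less_iff complex.sel greaterThanLessThan_iff
    by (rule iffI; elim conjE; intro conjI; linarith)
  have Q_sub: "Q \<subseteq> ?U"
  proof
    fix z assume "z \<in> Q"
    then have "\<bar>Re z - Re x\<bar> \<le> 2 * d" "0 < Im z" "Im z \<le> 2 * d"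
      using d unfolding Q_iff by linarith+
    then have "z \<in> R" "0 < Im z" unfolding R_iff by linarith+
    then show "z \<in> ?U" using R_sub by blast
  qed
  define B where "B = exp 2 * (6 * M / d)"
  have deriv_le: "norm (deriv g z) \<le> B" if z: "z \<in> Q" for z
  proof -
    let ?\<rho> = "Im z / 2"
    have close: "\<bar>Re w - Re x\<bar> \<le> d \<and> 0 < Im w \<and> Im w < d \<and> Im w \<le> 3 / 2 * Im z"
      if "w \<in> cball z ?\<rho>" for w
    proof -
      have "norm (w - z) \<le> Im z / 2"
        using that by (simp add: dist_norm norm_minus_commute)
      then have "\<bar>Re w - Re z\<bar> \<le> Im z / 2" "\<bar>Im w - Im z\<bar> \<le> Im z / 2"
        using abs_Re_le_cmod[of "w - z"] abs_Im_le_cmod[of "w - z"] by simp_all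
      then show ?thesis
        using z unfolding Q_iff by linarith
    qed
    have "norm (deriv g z) \<le> exp 2 * (3 * M / d * Im z) / ?\<rho>"
    proof (rule deriv_bound_by_Im[OF holg openU])
      show "cball z ?\<rho> \<subseteq> ?U"
      proof
        fix w assume "w \<in> cball z ?\<rho>"
        from close[OF this] have "w \<in> R" "0 < Im w"
          using d unfolding R_iff by linarith+
        then show "w \<in> ?U" using R_sub by auto
      qed
      show "\<bar>Im (g w)\<bar> \<le> 3 * M / d * Im z" if "w \<in> cball z ?\<rho>" for w
      proof -
        have "\<bar>Im (g w)\<bar> \<le> 2 * M / d * Im w"
          using close[OF that] by (intro lin) auto
        also have "\<dots> \<le> 2 * M / d * (3 / 2 * Im z)"
          using close[OF that] M(1) d by (intro mult_left_mono) auto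
        finally show ?thesis by simp
      qed
    qed (use z M d in \<open>auto simp: Q_iff\<close>)
    also have "\<dots> = B"
      using z by (simp add: B_def Q_iff field_simps)
    finally show ?thesis .
  qed
  have "B-lipschitz_on Q g"
  proof (rule lipschitz_onI)
    fix z w assume zw: "z \<in> Q" "w \<in> Q"
    have "norm (g z - g w) \<le> B * norm (z - w)"
    proof (rule field_differentiable_bound[OF _ _ deriv_le zw])
      show "convex Q" by (simp add: Q_def convex_box)
      show "(g has_field_derivative deriv g v) (at v within Q)" if "v \<in> Q" for v
        using holomorphic_derivI[OF holg openU] that Q_sub by blast
    qed
    then show "dist (g z) (g w) \<le> B * dist z w" by (simp add: dist_norm)
  qed (use M d in \<open>simp add: B_def\<close>)
  then have "uniformly_continuous_on Q g"
    by (rule lipschitz_on_uniformly_continuous)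
  moreover have "x \<in> closure Q"
  proof -
    have "Complex (Re x) (d / 4) \<in> Q" using d by (simp add: Q_iff)
    then have "closure Q = cbox (Complex (Re x - d / 2) 0) (Complex (Re x + d / 2) (d / 2))"
      unfolding Q_def by (intro closure_box) auto
    then show ?thesis using d x(2) by (simp add: in_cbox_complex_iff)
  qed
  ultimately obtain l where l: "(g \<longlongrightarrow> l) (at x within Q)"
    by (rule uniformly_continuous_on_extension_at_closure)
  have "at x within Q = at x within ?U"
  proof (rule at_within_nhd[of _ "ball x (d / 2)"])
    have "z \<in> Q" if "z \<in> ball x (d / 2)" "0 < Im z" for z
    proof -
      have "norm (z - x) < d / 2"
        using that(1) by (simp add: dist_norm norm_minus_commute)
      then have "\<bar>Re z - Re x\<bar> < d / 2" "\<bar>Im z\<bar> < d / 2"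
        using abs_Re_le_cmod[of "z - x"] abs_Im_le_cmod[of "z - x"] x(2) by simp_all
      then show ?thesis
        using that(2) unfolding Q_iff by linarith
    qed
    then show "Q \<inter> ball x (d / 2) - {x} = ?U \<inter> ball x (d / 2) - {x}"
      using Q_sub by auto
  qed (use d in auto)
  with l show ?thesis by auto
qed

section \<open>Reflection\<close>

lemma real_point_islimpt_upper:
  assumes "open S" "x \<in> S" "Im x = 0"
  shows "x islimpt S \<inter> {z. 0 < Im z}"
  unfolding islimpt_approachable
proof (intro allI impI)
  fix e :: real assume "e > 0"
  obtain e0 where e0: "e0 > 0" "ball x e0 \<subseteq> S"
    using assms open_contains_ball by blast
  define t where "t = min e e0 / 2"
  have t: "0 < t" "t < e" "t < e0"
    using \<open>e > 0\<close> e0 by (auto simp: t_def min_def)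
  have dist: "dist (x + \<i> * of_real t) x = t"
    using t by (simp add: dist_norm norm_mult)
  have "x + \<i> * of_real t \<in> S \<inter> {z. 0 < Im z}"
    using dist t e0(2) assms(3) by (auto simp: dist_commute)
  moreover have "x + \<i> * of_real t \<noteq> x" using t by simp
  ultimately show "\<exists>y\<in>S \<inter> {z. 0 < Im z}. y \<noteq> x \<and> dist y x < e"
    using dist t by metis
qed

lemma continuous_on_tendsto_within_subset:
  assumes "continuous_on A h" "x \<in> A" "B \<subseteq> A"
  shows "(h \<longlongrightarrow> h x) (at x within B)"
  using assms tendsto_within_subset by (fastforce simp: continuous_on_def)

text \<open>The reflection principle with a hypothesis on the imaginary part alone. Once
  \<open>g\<close> is known to have limits at the real points, it extends continuously to the
  closed upper side, these limits are real since \<open>u\<close> vanishes there, and the classical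
  principle applies to the extension.\<close>

theorem Schwarz_reflection_Im:
  fixes g :: "complex \<Rightarrow> complex" and u :: "complex \<Rightarrow> real"
  assumes S: "open S" "cnj ` S \<subseteq> S"
    and holg: "g holomorphic_on (S \<inter> {z. 0 < Im z})"
    and contu: "continuous_on (S \<inter> {z. 0 \<le> Im z}) u"
    and u: "\<And>z. z \<in> S \<Longrightarrow> 0 < Im z \<Longrightarrow> u z = Im (g z)"
    and u0: "\<And>z. z \<in> S \<Longrightarrow> Im z = 0 \<Longrightarrow> u z = 0"
  obtains G where "G holomorphic_on S"
    and "\<And>z. z \<in> S \<Longrightarrow> 0 < Im z \<Longrightarrow> G z = g z"
    and "\<And>z. z \<in> S \<Longrightarrow> Im z < 0 \<Longrightarrow> G z = cnj (g (cnj z))"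
    and "\<And>z. z \<in> S \<Longrightarrow> Im z = 0 \<Longrightarrow> (g \<longlongrightarrow> G z) (at z within S \<inter> {z. 0 < Im z})"
proof -
  let ?U = "S \<inter> {z. 0 < Im z}" and ?T = "S \<inter> {z. 0 \<le> Im z}"
  have lim: "\<exists>l. (g \<longlongrightarrow> l) (at x within ?U)" if "x \<in> ?T - ?U" for x
  proof (rule limit_at_real_point[OF S(1) holg contu])
    show "x \<in> S" "Im x = 0" using that by auto
  qed (use u u0 in auto)
  obtain h where h: "continuous_on ?T h" "\<And>z. z \<in> ?U \<Longrightarrow> h z = g z"
  proof (rule continuous_map_extension_pointwise_alt[of euclidean ?U ?T euclidean g])
    show "regular_space (euclidean :: complex topology)" by (rule regular_space_euclidean)
    show "?U \<subseteq> ?T" by auto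
    show "?T \<subseteq> euclidean closure_of ?U"
    proof
      fix z assume z: "z \<in> ?T"
      then have "z \<in> ?U \<or> z islimpt ?U"
        using real_point_islimpt_upper[OF S(1), of z] by (cases "Im z = 0") auto
      then show "z \<in> euclidean closure_of ?U" by (auto simp: closure_def)
    qed
    show "continuous_map (top_of_set ?U) euclidean g"
      using holomorphic_on_imp_continuous_on[OF holg] by simp
    show "\<exists>l. limitin euclidean g l (atin_within euclidean x ?U)" if "x \<in> ?T - ?U" for x
      using lim[OF that]
      by (simp add: atin_within_def at_within_def nhdsin_def nhds_def)
  qed (use that in simp)
  have lim_h: "(g \<longlongrightarrow> h x) (at x within ?U)" if "x \<in> S" "Im x = 0" for x
  proof -
    have "(h \<longlongrightarrow> h x) (at x within ?U)"
      by (rule continuous_on_tendsto_within_subset[OF h(1)]) (use that in auto)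
    moreover have "\<forall>\<^sub>F z in at x within ?U. h z = g z"
      using h(2) by (auto simp: eventually_at_filter)
    ultimately show ?thesis by (rule Lim_transform_eventually)
  qed
  have real: "h x \<in> \<real>" if x: "x \<in> S" "x \<in> \<real>" for x
  proof -
    have Imx: "Im x = 0" using x(2) by (simp add: complex_is_Real_iff)
    have nontriv: "at x within ?U \<noteq> bot"
      using real_point_islimpt_upper[OF S(1) x(1) Imx] trivial_limit_within by blast
    have "((\<lambda>z. Im (g z)) \<longlongrightarrow> Im (h x)) (at x within ?U)"
      by (intro tendsto_intros lim_h x(1) Imx)
    moreover have "((\<lambda>z. Im (g z)) \<longlongrightarrow> 0) (at x within ?U)"
    proof (rule Lim_transform_eventually)
      show "(u \<longlongrightarrow> 0) (at x within ?U)"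
        using continuous_on_tendsto_within_subset[OF contu, of x ?U] x(1) Imx u0[OF x(1) Imx]
        by fastforce
      show "\<forall>\<^sub>F z in at x within ?U. u z = Im (g z)"
        using u by (auto simp: eventually_at_filter)
    qed
    ultimately have "Im (h x) = 0"
      using nontriv tendsto_unique by blast
    then show ?thesis by (simp add: complex_is_Real_iff)
  qed
  show thesis
  proof
    show "(\<lambda>z. if 0 \<le> Im z then h z else cnj (h (cnj z))) holomorphic_on S"
    proof (rule Schwarz_reflection[OF S _ h(1) real])
      show "h holomorphic_on ?U"
        using holg by (rule holomorphic_transform) (use h(2) in simp)
    qed
    show "(if 0 \<le> Im z then h z else cnj (h (cnj z))) = g z" if "z \<in> S" "0 < Im z" for z
      using that h(2) by simp
    show "(if 0 \<le> Im z then h z else cnj (h (cnj z))) = cnj (g (cnj z))"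
      if "z \<in> S" "Im z < 0" for z
    proof -
      have "cnj z \<in> ?U" using that S(2) by auto
      then show ?thesis using that h(2) by simp
    qed
    show "(g \<longlongrightarrow> (if 0 \<le> Im z then h z else cnj (h (cnj z)))) (at z within ?U)"
      if "z \<in> S" "Im z = 0" for z
      using lim_h[OF that] that by simp
  qed
qed

section \<open>The complexified series and the continuation\<close>

lemma complexified_series_sums:
  assumes conv: "\<And>x::real. \<bar>x\<bar> < r \<Longrightarrow> summable (\<lambda>n. a n * x ^ n)" and z: "norm z < r"
  shows "(\<lambda>n. of_real (a n) * z ^ n) sums complexified_series a z"
proof -
  obtain x where x: "norm z < x" "x < r" using z dense by blast
  then have "summable (\<lambda>n. a n * x ^ n)"
    using norm_ge_zero[of z] by (intro conv) linarith
  then have "summable (\<lambda>n. complex_of_real (a n * x ^ n))"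
    by (simp only: summable_complex_of_real)
  then have "summable (\<lambda>n. complex_of_real (a n) * of_real x ^ n)"
    by simp
  then have "summable (\<lambda>n. complex_of_real (a n) * z ^ n)"
    by (rule powser_inside) (use x in auto)
  then show ?thesis
    unfolding complexified_series_def by (rule summable_sums)
qed

lemma complexified_series_holomorphic:
  assumes "\<And>x::real. \<bar>x\<bar> < r \<Longrightarrow> summable (\<lambda>n. a n * x ^ n)"
  shows "complexified_series a holomorphic_on ball 0 r"
  using complexified_series_sums[of r a, OF assms]
  by (intro power_series_holomorphic[where a = "\<lambda>n. of_real (a n)"]) simp

lemma complexified_series_cnj:
  assumes "\<And>x::real. \<bar>x\<bar> < r \<Longrightarrow> summable (\<lambda>n. a n * x ^ n)" "norm z < r"
  shows "complexified_series a (cnj z) = cnj (complexified_series a z)"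
proof -
  have "(\<lambda>n. cnj (of_real (a n) * z ^ n)) sums cnj (complexified_series a z)"
    using complexified_series_sums[of r a, OF assms] by (simp only: sums_cnj)
  then show ?thesis
    using complexified_series_sums[of r a "cnj z", OF assms(1)] assms(2) sums_unique2 by auto
qed

theorem theorem1p2:
  fixes f :: "complex \<Rightarrow> complex"
    and V :: "complex \<Rightarrow> real"
    and a :: "nat \<Rightarrow> real"
    and r :: real
  assumes "f holomorphic_on upper_half_disc 1"
    and "continuous_on (upper_half_disc 1 \<union> real_diameter) V"
    and "\<And>z. z \<in> upper_half_disc 1 \<Longrightarrow> V z = Im (f z)"
    and "0 < r" and "r \<le> 1"
    and "\<And>x::real. \<bar>x\<bar> < r \<Longrightarrow> (\<lambda>n. a n * x ^ n) sums V (complex_of_real x)"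
  shows "(\<forall>x::real. \<bar>x\<bar> < r \<longrightarrow>
            (\<exists>l. (f \<longlongrightarrow> l) (at (complex_of_real x) within upper_half_disc 1))) \<and>
         (\<exists>F. F holomorphic_on (upper_half_disc 1 \<union> ball 0 r) \<and>
            (\<forall>z \<in> upper_half_disc 1. F z = f z) \<and>
            (\<forall>z \<in> ball 0 r - upper_half_disc r.
               F z = cnj (boundary_value_ext f (cnj z)) + 2 * \<i> * complexified_series a z))"
proof -
  let ?S = "ball (0::complex) r"
  let ?U = "?S \<inter> {z. 0 < Im z}" and ?T = "?S \<inter> {z. 0 \<le> Im z}"
  let ?D = "upper_half_disc 1"
  define v where "v = complexified_series a"
  define g where "g z = f z - \<i> * v z" for z
  define u where "u z = V z - Re (v z)" for z
  have UD: "?U \<subseteq> ?D" and TD: "?T \<subseteq> ?D \<union> real_diameter"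
    using \<open>r \<le> 1\<close>
    by (auto simp: upper_half_disc_def real_diameter_def complex_is_Real_iff)
  have openD: "open ?D"
    unfolding upper_half_disc_def Collect_conj_eq Collect_mem_eq
    by (intro open_Int open_ball open_halfspace_Im_gt)
  have summ: "summable (\<lambda>n. a n * x ^ n)" if "\<bar>x\<bar> < r" for x
    using assms(6)[OF that] by (rule sums_summable)
  have holv: "v holomorphic_on ?S"
    unfolding v_def using summ by (rule complexified_series_holomorphic)
  have v_cnj: "v (cnj z) = cnj (v z)" if "z \<in> ?S" for z
    unfolding v_def using complexified_series_cnj[of r a z] summ that by simp
  have v_real: "v z = of_real (V z)" if "z \<in> ?S" "Im z = 0" for z
  proof -
    define x where "x = Re z"
    have zx: "z = of_real x" using that(2) by (simp add: x_def complex_eq_iff)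
    have "\<bar>x\<bar> < r" using that(1) by (simp add: zx)
    then have "(\<lambda>n. complex_of_real (a n * x ^ n)) sums of_real (V z)"
      using assms(6) by (simp only: sums_of_real_iff zx)
    then show ?thesis
      using complexified_series_sums[of r a z] summ that(1) sums_unique2
      by (fastforce simp: v_def zx)
  qed
  have holg: "g holomorphic_on ?U"
    unfolding g_def
    by (intro holomorphic_intros holomorphic_on_subset[OF assms(1) UD]
          holomorphic_on_subset[OF holv]) auto
  have contu: "continuous_on ?T u"
    unfolding u_def
    by (intro continuous_intros continuous_on_subset[OF assms(2) TD]
          continuous_on_subset[OF holomorphic_on_imp_continuous_on[OF holv]]) auto
  have u: "u z = Im (g z)" if "z \<in> ?S" "0 < Im z" for z
    using assms(3)[of z] UD that by (auto simp: u_def g_def)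
  have u0: "u z = 0" if "z \<in> ?S" "Im z = 0" for z
    using v_real[OF that] by (simp add: u_def)
  obtain G where G: "G holomorphic_on ?S"
    and G_upper: "\<And>z. z \<in> ?S \<Longrightarrow> 0 < Im z \<Longrightarrow> G z = g z"
    and G_lower: "\<And>z. z \<in> ?S \<Longrightarrow> Im z < 0 \<Longrightarrow> G z = cnj (g (cnj z))"
    and G_real: "\<And>z. z \<in> ?S \<Longrightarrow> Im z = 0 \<Longrightarrow> (g \<longlongrightarrow> G z) (at z within ?U)"
    proof (rule Schwarz_reflection_Im[OF open_ball _ holg contu u u0])
    show "cnj ` ?S \<subseteq> ?S" by auto
  qed (assumption | rule that)+
  \<comment> \<open>\<open>G\<close> continues \<open>f - \<i> v\<close>, so \<open>H\<close> continues \<open>f\<close> to the whole disc of radius \<open>r\<close>.\<close>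
  define H where "H z = G z + \<i> * v z" for z
  have holH: "H holomorphic_on ?S"
    unfolding H_def by (intro holomorphic_intros G holv)
  have H_upper: "H z = f z" if "z \<in> ?S" "0 < Im z" for z
    using G_upper[OF that] by (simp add: H_def g_def)
  have nontriv: "at z within ?D \<noteq> bot" and lim_f: "(f \<longlongrightarrow> H z) (at z within ?D)"
    if z: "z \<in> ?S" "Im z = 0" for z
  proof -
    have eq: "at z within ?D = at z within ?U"
      by (rule at_within_nhd[of _ ?S])
        (use z \<open>r \<le> 1\<close> in \<open>auto simp: upper_half_disc_def\<close>)
    show "at z within ?D \<noteq> bot"
      unfolding eq using real_point_islimpt_upper[of ?S z] z trivial_limit_within open_ball by blast
    have "(v \<longlongrightarrow> v z) (at z within ?U)"
      by (rule continuous_on_tendsto_within_subset[OF holomorphic_on_imp_continuous_on[OF holv]])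
        (use z(1) in auto)
    then have "((\<lambda>w. g w + \<i> * v w) \<longlongrightarrow> H z) (at z within ?U)"
      unfolding H_def by (intro tendsto_intros G_real z)
    then show "(f \<longlongrightarrow> H z) (at z within ?D)"
      by (simp add: g_def eq)
  qed
  have H_rest: "H z = cnj (boundary_value_ext f (cnj z)) + 2 * \<i> * v z"
    if z: "z \<in> ?S" "Im z \<le> 0" for z
  proof (cases "Im z = 0")
    case True
    have "cnj z = z" using True by (simp add: complex_eq_iff)
    moreover have "z \<notin> ?D" using True by (simp add: upper_half_disc_def)
    ultimately have "boundary_value_ext f (cnj z) = H z"
      using tendsto_Lim[OF nontriv lim_f] z(1) True by (simp add: boundary_value_ext_def)
    \<comment> \<open>At a real point the formula reads \<open>H z = cnj (H z) + 2 \<i> V z\<close>, which only concerns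
      imaginary parts.\<close>
    moreover have "Im (H z) = V z"
    proof -
      have "((\<lambda>w. Im (f w)) \<longlongrightarrow> Im (H z)) (at z within ?D)"
        by (intro tendsto_intros lim_f z True)
      moreover have "((\<lambda>w. Im (f w)) \<longlongrightarrow> V z) (at z within ?D)"
      proof (rule Lim_transform_eventually)
        show "(V \<longlongrightarrow> V z) (at z within ?D)"
          by (rule continuous_on_tendsto_within_subset[OF assms(2)])
            (use TD z(1) True in auto)
        show "\<forall>\<^sub>F w in at z within ?D. V w = Im (f w)"
          using assms(3) by (auto simp: eventually_at_filter)
      qed
      ultimately show ?thesis
        using nontriv[OF z(1) True] tendsto_unique by blast
    qed
    ultimately show ?thesis
      using v_real[OF z(1) True] by (simp add: complex_eq_iff)
  next
    case False
    then have "cnj z \<in> ?U" using z by simp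
    then have "cnj z \<in> ?D" using UD by blast
    then show ?thesis
      using G_lower[OF z(1)] v_cnj[OF z(1)] z(2) False
      by (simp add: H_def g_def boundary_value_ext_def)
  qed
  define F where "F z = (if z \<in> ?D then f z else H z)" for z
  have F_S: "F z = H z" if "z \<in> ?S" for z
    using H_upper[OF that] by (auto simp: F_def upper_half_disc_def)
  have "F holomorphic_on (?D \<union> ?S)"
  proof (rule holomorphic_on_Un)
    show "F holomorphic_on ?D"
      using assms(1) by (simp add: F_def cong: holomorphic_cong)
    show "F holomorphic_on ?S"
      using holH by (rule holomorphic_transform) (simp add: F_S)
  qed (use openD in auto)
  moreover have "\<forall>z\<in>?D. F z = f z"
    by (simp add: F_def)
  moreover have "\<forall>z\<in>?S - upper_half_disc r.
      F z = cnj (boundary_value_ext f (cnj z)) + 2 * \<i> * complexified_series a z"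
  proof
    fix z assume z: "z \<in> ?S - upper_half_disc r"
    then have "z \<in> ?S" "Im z \<le> 0" by (auto simp: upper_half_disc_def)
    then show "F z = cnj (boundary_value_ext f (cnj z)) + 2 * \<i> * complexified_series a z"
      using F_S H_rest by (simp add: v_def)
  qed
  moreover have "\<exists>l. (f \<longlongrightarrow> l) (at (complex_of_real x) within ?D)" if "\<bar>x\<bar> < r" for x
    using lim_f[of "of_real x"] that by auto
  ultimately show ?thesis by blast
qed

end
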